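(* There are constants $(C_d)_{d\ge 3}$ with $C_3\le 6.3$, $C_d\le 3\sqrt d$ for all $d\ge 4$, and $C_d/\sqrt d\to 2$ as $d\to\infty$, such that the following holds. If $d\ge1$, $\mu$ is any probability measure on $[0,1]^d$ and $(X_k)_{k\ge 0}$ are i.i.d. random variables with law $\mu$, then for all integers $n\ge 1$, with $\hat\mu_n=\frac1n\sum_{k=1}^n\delta_{X_k}$, \[ \mathbb{E}\big[W_1(\hat\mu_n,\mu)\big]\le \begin{cases} \dfrac{1}{2(\sqrt2-1)}\cdot\dfrac{1}{\sqrt n} & \text{when } d=1,\\[2ex] \dfrac{\log_2(n)+8}{\sqrt{8n}} & \text{when } d=2,\\[2ex] \dfrac{C_d}{n^{1/d}} & \text{when } d\ge 3. \end{cases} \]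
   Context: $W_1$ is the $1$-Wasserstein metric with respect to the Euclidean norm: $W_1(\nu_0,\nu_1)=\sup_f|\int f\,d\nu_0-\int f\,d\nu_1|$ over all functions $f:[0,1]^d\to\mathbb{R}$ that are $1$-Lipschitz for the Euclidean norm (equivalently, the infimum of $\mathbb{E}\lVert X-Y\rVert$ over couplings $X\sim\nu_0$, $Y\sim\nu_1$). *)

theory Defs
  imports "HOL-Probability.Probability"
begin

text \<open>
  The dimension has to range over all natural numbers inside a single proposition, so points of
  the cube are extensional functions on \<open>{..<d}\<close> instead of elements of a type indexed by its
  dimension. The space of \<open>unit_cube d\<close> is \<open>[0,1]^d\<close>, equipped with its Borel sets.
\<close>

definition unit_cube :: "nat \<Rightarrow> (nat \<Rightarrow> real) measure" where
  "unit_cube d = PiM {..<d} (\<lambda>_. restrict_space borel {0..1})"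

lemma space_unit_cube: "space (unit_cube d) = {..<d} \<rightarrow>\<^sub>E {0..1}"
  by (simp add: unit_cube_def space_PiM space_restrict_space)

definition euclidean_dist :: "nat \<Rightarrow> (nat \<Rightarrow> real) \<Rightarrow> (nat \<Rightarrow> real) \<Rightarrow> real" where
  "euclidean_dist d x y = L2_set (\<lambda>i. x i - y i) {..<d}"

text \<open>Only the values of \<open>f\<close> on the cube matter; \<open>f\<close> is arbitrary elsewhere.\<close>

definition lipschitz1_cube :: "nat \<Rightarrow> ((nat \<Rightarrow> real) \<Rightarrow> real) set" where
  "lipschitz1_cube d = {f. \<forall>x\<in>space (unit_cube d). \<forall>y\<in>space (unit_cube d).
     \<bar>f x - f y\<bar> \<le> euclidean_dist d x y}"

text \<open>
  Meant for probability measures with the same measurable space as \<open>unit_cube d\<close>. For these the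
  functions \<open>f\<close> are integrable and the set of values is bounded by the diameter of the cube, so
  the real-valued supremum is the true one.
\<close>

definition W1 :: "nat \<Rightarrow> (nat \<Rightarrow> real) measure \<Rightarrow> (nat \<Rightarrow> real) measure \<Rightarrow> real" where
  "W1 d \<nu>0 \<nu>1 = (SUP f\<in>lipschitz1_cube d. \<bar>(\<integral>x. f x \<partial>\<nu>0) - (\<integral>x. f x \<partial>\<nu>1)\<bar>)"

text \<open>\<open>N\<close> only provides the measurable space; the points are \<open>x 1, \<dots>, x n\<close>, without \<open>x 0\<close>.\<close>

definition empirical_measure :: "'b measure \<Rightarrow> nat \<Rightarrow> (nat \<Rightarrow> 'b) \<Rightarrow> 'b measure" where
  "empirical_measure N n x =
     measure_of (space N) (sets N) (\<lambda>A. (\<Sum>k=1..n. emeasure (return N (x k)) A) / of_nat n)"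

lemma space_empirical_measure [simp]: "space (empirical_measure N n x) = space N"
  and sets_empirical_measure [simp]: "sets (empirical_measure N n x) = sets N"
  by (simp_all add: empirical_measure_def)

lemma emeasure_empirical_measure:
  assumes "A \<in> sets N"
  shows "emeasure (empirical_measure N n x) A =
    (\<Sum>k=1..n. emeasure (return N (x k)) A) / of_nat n"
proof (rule emeasure_measure_of[OF empirical_measure_def])
  show "sets N \<subseteq> Pow (space N)" by (rule sets.space_closed)
  show "A \<in> sets (empirical_measure N n x)" using assms by simp
  show "positive (sets (empirical_measure N n x))
      (\<lambda>A. (\<Sum>k=1..n. emeasure (return N (x k)) A) / of_nat n)"
    by (simp add: positive_def)
  show "countably_additive (sets (empirical_measure N n x))
      (\<lambda>A. (\<Sum>k=1..n. emeasure (return N (x k)) A) / of_nat n)"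
  proof (rule countably_additiveI)
    fix B :: "nat \<Rightarrow> _"
    assume B: "range B \<subseteq> sets (empirical_measure N n x)" "disjoint_family B"
    have "(\<Sum>i. (\<Sum>k=1..n. emeasure (return N (x k)) (B i)) / of_nat n)
        = (\<Sum>i. \<Sum>k=1..n. emeasure (return N (x k)) (B i)) / of_nat n"
      by (simp add: divide_ennreal_def)
    also have "(\<Sum>i. \<Sum>k=1..n. emeasure (return N (x k)) (B i))
        = (\<Sum>k=1..n. \<Sum>i. emeasure (return N (x k)) (B i))"
      by (rule suminf_sum) simp
    also have "\<dots> = (\<Sum>k=1..n. emeasure (return N (x k)) (\<Union>i. B i))"
      using B by (intro sum.cong refl suminf_emeasure) auto
    finally show "(\<Sum>i. (\<Sum>k=1..n. emeasure (return N (x k)) (B i)) / of_nat n) =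
      (\<Sum>k=1..n. emeasure (return N (x k)) (\<Union>i. B i)) / of_nat n" .
  qed
qed

definition iid_sequence :: "'a measure \<Rightarrow> 'b measure \<Rightarrow> (nat \<Rightarrow> 'a \<Rightarrow> 'b) \<Rightarrow> bool" where
  "iid_sequence M \<mu> X \<longleftrightarrow>
     prob_space M \<and> prob_space.indep_vars M (\<lambda>_. \<mu>) X UNIV \<and> (\<forall>k. distr M \<mu> (X k) = \<mu>)"

end

theory Submission
  imports Defs
begin

text \<open>
  By definition \<open>W1\<close> asks how differently the empirical measure and \<open>\<mu>\<close> integrate a Lipschitz function
  \<open>f\<close>. Split \<open>f\<close> into scales: let \<open>f\<^sub>l\<close> be \<open>f\<close> evaluated at the centre of the dyadic cell of side length
  \<open>1 / 2 ^ l\<close> that contains the point. Then \<open>f\<^sub>0\<close> is constant and contributes nothing, \<open>f - f\<^sub>L\<close> is at most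
  \<open>sqrt d / 2 ^ (L + 1)\<close>, and the increment from \<open>f\<^sub>l\<close> to the next level is constant on the cells of
  level \<open>l + 1\<close> and at most \<open>sqrt d / 2 ^ (l + 2)\<close>. So \<open>W1\<close> is bounded by a weighted sum of the total
  deviations between empirical frequencies and probabilities of the cells of each level
  (\<open>W1_le_multiscale\<close>), a bound in which \<open>f\<close> no longer occurs. This makes the supremum over \<open>f\<close>
  harmless when expectations are taken.

  The frequency of a cell \<open>Q\<close> has variance at most \<open>\<mu>(Q) / n\<close>. By the Cauchy-Schwarz inequality, which
  is used in a linearised form, the deviations of the at most \<open>2 ^ (d * l)\<close> cells of level \<open>l\<close> sum up to
  at most \<open>sqrt (2 ^ (d * l) / n)\<close> in expectation (\<open>expected_cell_discrepancy\<close>). Altogether, for every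
  number \<open>L\<close> of levels, the expected distance is at most \<open>sqrt d * (1 / 2 ^ L + (r + \<dots> + r ^ L) / (2 * sqrt n))\<close> with
  \<open>r = sqrt 2 ^ d / 2\<close> (\<open>expected_W1_le_geometric\<close>). For \<open>d = 1\<close> the geometric series converges and \<open>L\<close> tends
  to infinity; for \<open>d = 2\<close> all its terms are \<open>1\<close>, whence the logarithm; for \<open>d \<ge> 3\<close> the last term
  dominates, and \<open>L\<close> is chosen such that \<open>2 ^ L\<close> is about \<open>n powr (1 / d)\<close>.

  That the distance is a random variable at all follows from the same discretisation: it is the
  limit of the distances for rounded sample points, and these take finitely many values.
\<close>

section \<open>Dyadic cells of the cube\<close>

text \<open>
  The dyadic cells of the unit interval, described by their centres: \<open>bisect l t\<close> is the centre of
  the cell of length \<open>1 / 2 ^ l\<close> that binary search finds for \<open>t\<close>. A recursion on the level, rather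
  than a rounding formula, gives the step size between consecutive levels by definition and takes
  care of the right end point \<open>t = 1\<close>, which binary search puts into the last cell.
\<close>

primrec bisect :: "nat \<Rightarrow> real \<Rightarrow> real" where
  "bisect 0 t = 1 / 2"
| "bisect (Suc l) t = bisect l t + (if t < bisect l t then - 1 else 1) / 2 ^ (l + 2)"

lemma bisect_step: "\<bar>bisect (Suc l) t - bisect l t\<bar> = 1 / 2 ^ (l + 2)"
  by simp

lemma bisect_error:
  assumes "t \<in> {0..1}"
  shows "\<bar>bisect l t - t\<bar> \<le> 1 / 2 ^ (l + 1)"
proof (induction l)
  case 0
  show ?case using assms by (auto simp: abs_if)
next
  case (Suc l)
  define e :: real where "e = 1 / 2 ^ (l + 2)"
  have e: "1 / 2 ^ (l + 1) = 2 * e" "1 / 2 ^ (Suc l + 1) = e"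
    by (simp_all add: e_def)
  have "bisect (Suc l) t = (if t < bisect l t then bisect l t - e else bisect l t + e)"
    by (simp add: e_def)
  with Suc show ?case unfolding e abs_le_iff
    by (cases "t < bisect l t") (simp_all only: if_True if_False, linarith+)
qed

text \<open>
  Stated with a margin because a centre only stays inside the interval under further bisection
  if it keeps half a cell away from the boundary.
\<close>

lemma bisect_margin: "bisect l t \<in> {1 / 2 ^ (l + 1) .. 1 - 1 / 2 ^ (l + 1)}"
proof (induction l)
  case 0
  show ?case by simp
next
  case (Suc l)
  define e :: real where "e = 1 / 2 ^ (l + 2)"
  have e: "1 / 2 ^ (l + 1) = 2 * e" "1 / 2 ^ (Suc l + 1) = e"
    by (simp_all add: e_def)
  have "bisect (Suc l) t = bisect l t - e \<or> bisect (Suc l) t = bisect l t + e"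
    by (simp add: e_def)
  moreover have "0 < e" by (simp add: e_def)
  ultimately show ?case using Suc unfolding e atLeastAtMost_iff by linarith
qed

lemma bisect_in_unit_interval: "bisect l t \<in> {0..1}"
proof -
  have "0 \<le> (1::real) / 2 ^ (l + 1)" by simp
  then show ?thesis
    using bisect_margin[of l t] unfolding atLeastAtMost_iff by linarith
qed

lemma bisect_dyadic: "\<exists>k::int. bisect l t = (of_int k + 1 / 2) / 2 ^ l"
proof (induction l)
  case 0
  show ?case by (auto intro: exI[of _ 0])
next
  case (Suc l)
  then obtain k :: int where k: "bisect l t = (of_int k + 1 / 2) / 2 ^ l" ..
  show ?case
  proof (cases "t < bisect l t")
    case True
    then have "bisect (Suc l) t = (of_int (2 * k) + 1 / 2) / 2 ^ Suc l"
      using k by (simp add: add_divide_distrib)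
    then show ?thesis by blast
  next
    case False
    then have "bisect (Suc l) t = (of_int (2 * k + 1) + 1 / 2) / 2 ^ Suc l"
      using k by (simp add: add_divide_distrib)
    then show ?thesis by blast
  qed
qed

text \<open>
  Different centres of level \<open>l\<close> differ by a nonzero multiple of \<open>1 / 2 ^ l\<close>. This turns the metric
  estimates on binary search into equalities, in particular into the nesting of the cells.
\<close>

lemma bisect_separated:
  assumes "\<bar>bisect l s - bisect l t\<bar> < 1 / 2 ^ l"
  shows "bisect l s = bisect l t"
proof -
  obtain j k :: int where jk: "bisect l s = (of_int j + 1 / 2) / 2 ^ l" "bisect l t = (of_int k + 1 / 2) / 2 ^ l"
    using bisect_dyadic by metis
  have "bisect l s - bisect l t = of_int (j - k) / 2 ^ l"
    unfolding jk by (simp add: field_simps)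
  with assms have "\<bar>of_int (j - k)\<bar> / 2 ^ l < (1::real) / 2 ^ l"
    by simp
  then have "\<bar>of_int (j - k)\<bar> < (1::real)"
    by (simp add: divide_less_cancel)
  then have "j = k" by linarith
  then show ?thesis by (simp add: jk)
qed

text \<open>
  A cell of level \<open>l + 1\<close> lies inside one cell of level \<open>l\<close>: a point and the centre of its fine cell
  have coarse centres that are less than \<open>1 / 2 ^ l\<close> apart.
\<close>

lemma bisect_coarsen: "bisect l (bisect (Suc l) t) = bisect l t"
proof (rule bisect_separated)
  have "\<bar>bisect l (bisect (Suc l) t) - bisect (Suc l) t\<bar> \<le> 1 / 2 ^ (l + 1)"
    by (rule bisect_error[OF bisect_in_unit_interval])
  moreover have "\<bar>bisect (Suc l) t - bisect l t\<bar> = 1 / 2 ^ (l + 2)"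
    by (rule bisect_step)
  moreover have "(1::real) / 2 ^ l = 2 * (1 / 2 ^ (l + 1))"
    "(1::real) / 2 ^ (l + 1) = 2 * (1 / 2 ^ (l + 2))"
    "0 < (1::real) / 2 ^ (l + 2)" by simp_all
  ultimately show "\<bar>bisect l (bisect (Suc l) t) - bisect l t\<bar> < 1 / 2 ^ l"
    by linarith
qed

lemma bisect_idem: "bisect l (bisect l t) = bisect l t"
proof (rule bisect_separated)
  have "(1::real) / 2 ^ (l + 1) < 1 / 2 ^ l" by (simp add: field_simps)
  with bisect_error[OF bisect_in_unit_interval]
  show "\<bar>bisect l (bisect l t) - bisect l t\<bar> < 1 / 2 ^ l"
    by (rule le_less_trans)
qed

text \<open>
  Each bisection step at most doubles the number of centres. It is important for the final
  constants that there are only \<open>2 ^ l\<close> of them, with no extra cell for an end point.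
\<close>

lemma finite_card_range_bisect: "finite (range (bisect l)) \<and> card (range (bisect l)) \<le> 2 ^ l"
proof (induction l)
  case 0
  have "range (bisect 0) = {1 / 2}" by auto
  then show ?case by simp
next
  case (Suc l)
  let ?R = "range (bisect l)"
  let ?left = "(\<lambda>c. c - 1 / 2 ^ (l + 2)) ` ?R" and ?right = "(\<lambda>c. c + 1 / 2 ^ (l + 2)) ` ?R"
  have sub: "range (bisect (Suc l)) \<subseteq> ?left \<union> ?right"
    by auto
  have fin: "finite (?left \<union> ?right)" using Suc by simp
  have "card (range (bisect (Suc l))) \<le> card (?left \<union> ?right)"
    by (rule card_mono[OF fin sub])
  also have "\<dots> \<le> card ?left + card ?right" by (rule card_Un_le)
  also have "\<dots> \<le> card ?R + card ?R"
    using Suc by (intro add_mono card_image_le) auto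
  also have "\<dots> \<le> 2 ^ Suc l" using Suc by simp
  finally show ?case using finite_subset[OF sub fin] by simp
qed

lemma measurable_bisect [measurable]: "bisect l \<in> borel_measurable borel"
proof (induction l)
  case (Suc l)
  note Suc [measurable]
  show ?case unfolding bisect.simps by measurable
qed simp

definition grid :: "nat \<Rightarrow> nat \<Rightarrow> (nat \<Rightarrow> real) \<Rightarrow> nat \<Rightarrow> real" where
  "grid d l x = (\<lambda>i\<in>{..<d}. bisect l (x i))"

definition grid_points :: "nat \<Rightarrow> nat \<Rightarrow> (nat \<Rightarrow> real) set" where
  "grid_points d l = {..<d} \<rightarrow>\<^sub>E range (bisect l)"

lemma grid_in_grid_points: "grid d l x \<in> grid_points d l"
  unfolding grid_def grid_points_def by (simp add: restrict_PiE_iff)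

lemma grid_points_in_cube: "grid_points d l \<subseteq> space (unit_cube d)"
  unfolding grid_points_def space_unit_cube
  using bisect_in_unit_interval by (intro PiE_mono) blast

lemma grid_in_cube: "grid d l x \<in> space (unit_cube d)"
  using grid_in_grid_points grid_points_in_cube by blast

lemma finite_grid_points [simp]: "finite (grid_points d l)"
  unfolding grid_points_def by (intro finite_PiE finite_lessThan finite_card_range_bisect[THEN conjunct1])

lemma card_grid_points_le: "card (grid_points d l) \<le> 2 ^ (d * l)"
proof -
  have "card (grid_points d l) = card (range (bisect l)) ^ d"
    by (simp add: grid_points_def card_PiE)
  also have "\<dots> \<le> (2 ^ l) ^ d"
    using finite_card_range_bisect by (intro power_mono) auto
  finally show ?thesis by (simp add: power_mult[symmetric] mult.commute)
qed

lemma grid_coarsen: "grid d l (grid d (Suc l) x) = grid d l x"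
  unfolding grid_def by (simp add: fun_eq_iff restrict_def bisect_coarsen del: bisect.simps)

lemma grid_idem: "grid d l (grid d l x) = grid d l x"
  unfolding grid_def by (simp add: fun_eq_iff restrict_def bisect_idem)

lemma grid_0: "grid d 0 x = (\<lambda>i\<in>{..<d}. 1 / 2)"
  by (simp add: grid_def)

lemma measurable_grid: "grid d l \<in> measurable (unit_cube d) (count_space (grid_points d l))"
proof (subst measurable_count_space_eq2, simp, intro conjI ballI)
  fix q assume q: "q \<in> grid_points d l"
  have [measurable]: "(\<lambda>x. bisect l (x i)) \<in> borel_measurable (unit_cube d)" if "i \<in> {..<d}" for i
  proof -
    have "(\<lambda>x. x i) \<in> measurable (unit_cube d) (restrict_space borel {0..1})"
      unfolding unit_cube_def using that by (rule measurable_component_singleton)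
    then have "(\<lambda>x. x i) \<in> borel_measurable (unit_cube d)"
      by (simp add: measurable_restrict_space2_iff)
    then show ?thesis by measurable
  qed
  have "grid d l -` {q} \<inter> space (unit_cube d) =
      {x \<in> space (unit_cube d). \<forall>i\<in>{..<d}. bisect l (x i) = q i}"
    using q by (auto simp: grid_def grid_points_def fun_eq_iff PiE_def extensional_def)
  also have "\<dots> \<in> sets (unit_cube d)" by measurable
  finally show "grid d l -` {q} \<inter> space (unit_cube d) \<in> sets (unit_cube d)" .
qed (simp add: grid_in_grid_points)

section \<open>Lipschitz functions on the cube\<close>

lemma euclidean_dist_le_sup:
  assumes "\<And>i. i < d \<Longrightarrow> \<bar>x i - y i\<bar> \<le> e"
  shows "euclidean_dist d x y \<le> sqrt d * e"
proof (cases "d = 0")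
  case False
  then have "0 \<le> e" using assms[of 0] by linarith
  have "euclidean_dist d x y = L2_set (\<lambda>i. \<bar>x i - y i\<bar>) {..<d}"
    by (simp add: euclidean_dist_def L2_set_def)
  also have "\<dots> \<le> L2_set (\<lambda>i. e) {..<d}"
    using assms by (intro L2_set_mono) auto
  finally show ?thesis using \<open>0 \<le> e\<close> by (simp add: L2_set_constant)
qed (simp add: euclidean_dist_def)

lemma lipschitz_diff_le_sup:
  assumes "f \<in> lipschitz1_cube d" "x \<in> space (unit_cube d)" "y \<in> space (unit_cube d)"
    and "\<And>i. i < d \<Longrightarrow> \<bar>x i - y i\<bar> \<le> e"
  shows "\<bar>f x - f y\<bar> \<le> sqrt d * e"
proof -
  have "\<bar>f x - f y\<bar> \<le> euclidean_dist d x y"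
    using assms(1-3) by (simp add: lipschitz1_cube_def)
  also have "\<dots> \<le> sqrt d * e"
    by (rule euclidean_dist_le_sup[OF assms(4)])
  finally show ?thesis .
qed

lemma lipschitz_grid_error:
  assumes "f \<in> lipschitz1_cube d" "x \<in> space (unit_cube d)"
  shows "\<bar>f x - f (grid d l x)\<bar> \<le> sqrt d / 2 ^ (l + 1)"
proof -
  have "\<bar>x i - grid d l x i\<bar> \<le> 1 / 2 ^ (l + 1)" if "i < d" for i
  proof -
    have "x i \<in> {0..1}"
      using PiE_mem[OF assms(2)[unfolded space_unit_cube], of i] that by simp
    then have "\<bar>bisect l (x i) - x i\<bar> \<le> 1 / 2 ^ (l + 1)"
      by (rule bisect_error)
    then have "\<bar>x i - bisect l (x i)\<bar> \<le> 1 / 2 ^ (l + 1)"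
      by (subst abs_minus_commute)
    then show ?thesis
      unfolding grid_def restrict_def using that by simp
  qed
  then have "\<bar>f x - f (grid d l x)\<bar> \<le> sqrt d * (1 / 2 ^ (l + 1))"
    by (rule lipschitz_diff_le_sup[OF assms grid_in_cube])
  then show ?thesis by simp
qed

text \<open>
  Refining by one level moves the centre by a quarter of the coarse side length in each coordinate.
  This is a third of what the triangle inequality gives when both centres are compared with \<open>x\<close>, and
  the constants of the final bounds depend on it.
\<close>

lemma lipschitz_grid_step:
  assumes "f \<in> lipschitz1_cube d"
  shows "\<bar>f (grid d (Suc l) x) - f (grid d l x)\<bar> \<le> sqrt d / 2 ^ (l + 2)"
proof -
  have "\<bar>grid d (Suc l) x i - grid d l x i\<bar> \<le> 1 / 2 ^ (l + 2)" if "i < d" for i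
    using that bisect_step[of l "x i"] by (simp add: grid_def del: bisect.simps)
  from lipschitz_diff_le_sup[OF assms grid_in_cube grid_in_cube this] show ?thesis by simp
qed

lemma borel_measurable_comp_grid: "(\<lambda>x. g (grid d l x)) \<in> borel_measurable (unit_cube d)"
  for g :: "(nat \<Rightarrow> real) \<Rightarrow> real"
  using measurable_compose[OF measurable_grid, of g d l borel] by simp

text \<open>
  The functions in the definition of \<open>W1\<close> are not assumed to be measurable; they are, as pointwise
  limits of their values at the cell centres.
\<close>

lemma lipschitz_measurable:
  assumes f: "f \<in> lipschitz1_cube d"
  shows "f \<in> borel_measurable (unit_cube d)"
proof (rule borel_measurable_LIMSEQ_real)
  show "(\<lambda>x. f (grid d l x)) \<in> borel_measurable (unit_cube d)" for l
    by (rule borel_measurable_comp_grid)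
  fix x assume x: "x \<in> space (unit_cube d)"
  have "(\<lambda>l. sqrt d / 2 ^ (l + 1)) \<longlonglongrightarrow> 0"
    using LIMSEQ_divide_realpow_zero[of 2 "sqrt d"] by (intro LIMSEQ_ignore_initial_segment) simp
  then have "(\<lambda>l. f (grid d l x) - f x) \<longlonglongrightarrow> 0"
    by (rule Lim_null_comparison[rotated])
      (use lipschitz_grid_error[OF f x] in \<open>simp add: abs_minus_commute\<close>)
  then show "(\<lambda>l. f (grid d l x)) \<longlonglongrightarrow> f x"
    by (rule LIM_zero_cancel)
qed

lemma lipschitz_bounded:
  assumes f: "f \<in> lipschitz1_cube d" and x: "x \<in> space (unit_cube d)"
  shows "\<bar>f x\<bar> \<le> \<bar>f (\<lambda>i\<in>{..<d}. 1 / 2)\<bar> + sqrt d / 2"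
  using lipschitz_grid_error[OF f x, of 0] unfolding grid_0 power_one_right add_0 by linarith

lemma lipschitz_integrable:
  assumes f: "f \<in> lipschitz1_cube d" and \<nu>: "prob_space \<nu>" "sets \<nu> = sets (unit_cube d)"
  shows "integrable \<nu> f"
proof -
  interpret prob_space \<nu> by fact
  show ?thesis
  proof (rule integrable_const_bound)
    show "f \<in> borel_measurable \<nu>"
      using lipschitz_measurable[OF f] measurable_cong_sets[OF \<nu>(2) refl] by blast
    show "AE x in \<nu>. norm (f x) \<le> \<bar>f (\<lambda>i\<in>{..<d}. 1 / 2)\<bar> + sqrt d / 2"
      using lipschitz_bounded[OF f] sets_eq_imp_space_eq[OF \<nu>(2)] by (intro AE_I2) simp
  qed
qed

section \<open>The Wasserstein distance as a sum over scales\<close>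

definition cell :: "nat \<Rightarrow> nat \<Rightarrow> (nat \<Rightarrow> real) \<Rightarrow> (nat \<Rightarrow> real) set" where
  "cell d l q = grid d l -` {q} \<inter> space (unit_cube d)"

text \<open>
  Twice the total variation distance between the images of the two measures under the rounding map
  of level \<open>l\<close>.
\<close>

definition cell_discrepancy ::
  "nat \<Rightarrow> nat \<Rightarrow> (nat \<Rightarrow> real) measure \<Rightarrow> (nat \<Rightarrow> real) measure \<Rightarrow> real" where
  "cell_discrepancy d l \<nu>0 \<nu>1 = (\<Sum>q\<in>grid_points d l. \<bar>measure \<nu>0 (cell d l q) - measure \<nu>1 (cell d l q)\<bar>)"

lemma cell_sets: "cell d l q \<in> sets (unit_cube d)"
proof (cases "q \<in> grid_points d l")
  case True
  then show ?thesis
    unfolding cell_def using measurable_sets[OF measurable_grid, of "{q}" d l] by simp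
next
  case False
  then have "cell d l q = {}"
    unfolding cell_def using grid_in_grid_points by blast
  then show ?thesis by simp
qed

lemma integral_comp_grid:
  fixes g :: "(nat \<Rightarrow> real) \<Rightarrow> real"
  assumes \<nu>: "prob_space \<nu>" "sets \<nu> = sets (unit_cube d)"
  shows "integrable \<nu> (\<lambda>x. g (grid d l x))"
    and "(\<integral>x. g (grid d l x) \<partial>\<nu>) = (\<Sum>q\<in>grid_points d l. g q * measure \<nu> (cell d l q))"
proof -
  interpret prob_space \<nu> by fact
  let ?h = "\<lambda>x. \<Sum>q\<in>grid_points d l. g q * indicator (cell d l q) x"
  have eq: "g (grid d l x) = ?h x" if "x \<in> space \<nu>" for x
  proof -
    have "x \<in> space (unit_cube d)"
      using that sets_eq_imp_space_eq[OF \<nu>(2)] by simp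
    then have "?h x = (\<Sum>q\<in>grid_points d l. if q = grid d l x then g q else 0)"
      by (intro sum.cong refl) (auto simp: cell_def indicator_def)
    also have "\<dots> = g (grid d l x)"
      by (simp add: grid_in_grid_points)
    finally show ?thesis by simp
  qed
  have int: "integrable \<nu> (\<lambda>x. g q * indicator (cell d l q) x)" for q
    using cell_sets[of d l q] \<nu>(2) by (simp add: integrable_real_indicator less_top[symmetric])
  have "integrable \<nu> ?h" using int by (rule Bochner_Integration.integrable_sum)
  then show "integrable \<nu> (\<lambda>x. g (grid d l x))"
    by (subst Bochner_Integration.integrable_cong[OF refl eq])
  have "(\<integral>x. g (grid d l x) \<partial>\<nu>) = (\<integral>x. ?h x \<partial>\<nu>)"
    by (rule Bochner_Integration.integral_cong[OF refl eq])
  also have "\<dots> = (\<Sum>q\<in>grid_points d l. \<integral>x. g q * indicator (cell d l q) x \<partial>\<nu>)"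
    using int by (rule Bochner_Integration.integral_sum)
  also have "\<dots> = (\<Sum>q\<in>grid_points d l. g q * measure \<nu> (cell d l q))"
    using cell_sets \<nu>(2) by (intro sum.cong refl) (simp add: sets.Int_space_eq2)
  finally show "(\<integral>x. g (grid d l x) \<partial>\<nu>) = (\<Sum>q\<in>grid_points d l. g q * measure \<nu> (cell d l q))" .
qed

lemma integral_comp_grid_diff_le:
  fixes g :: "(nat \<Rightarrow> real) \<Rightarrow> real"
  assumes \<nu>0: "prob_space \<nu>0" "sets \<nu>0 = sets (unit_cube d)"
    and \<nu>1: "prob_space \<nu>1" "sets \<nu>1 = sets (unit_cube d)"
    and B: "\<And>q. \<bar>g q\<bar> \<le> B"
  shows "\<bar>(\<integral>x. g (grid d l x) \<partial>\<nu>0) - (\<integral>x. g (grid d l x) \<partial>\<nu>1)\<bar> \<le> B * cell_discrepancy d l \<nu>0 \<nu>1"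
proof -
  let ?D = "\<lambda>q. measure \<nu>0 (cell d l q) - measure \<nu>1 (cell d l q)"
  have "\<bar>(\<integral>x. g (grid d l x) \<partial>\<nu>0) - (\<integral>x. g (grid d l x) \<partial>\<nu>1)\<bar> = \<bar>\<Sum>q\<in>grid_points d l. g q * ?D q\<bar>"
    unfolding integral_comp_grid(2)[OF \<nu>0] integral_comp_grid(2)[OF \<nu>1]
    by (simp add: sum_subtractf right_diff_distrib)
  also have "\<dots> \<le> (\<Sum>q\<in>grid_points d l. \<bar>g q * ?D q\<bar>)" by (rule sum_abs)
  also have "\<dots> \<le> (\<Sum>q\<in>grid_points d l. B * \<bar>?D q\<bar>)"
    unfolding abs_mult using B by (intro sum_mono mult_right_mono) auto
  finally show ?thesis by (simp add: cell_discrepancy_def sum_distrib_left)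
qed

text \<open>
  Chaining over the scales. Rounding at level \<open>0\<close> gives a constant function, on which two probability
  measures agree; each further level adds a function of the finer cell, of size at most
  \<open>sqrt d / 2 ^ (l + 2)\<close>, which the two measures integrate differently only as far as they charge
  the finer cells differently.
\<close>

lemma integral_lipschitz_comp_grid_diff_le:
  assumes f: "f \<in> lipschitz1_cube d"
    and \<nu>0: "prob_space \<nu>0" "sets \<nu>0 = sets (unit_cube d)"
    and \<nu>1: "prob_space \<nu>1" "sets \<nu>1 = sets (unit_cube d)"
  shows "\<bar>(\<integral>x. f (grid d L x) \<partial>\<nu>0) - (\<integral>x. f (grid d L x) \<partial>\<nu>1)\<bar>
    \<le> (\<Sum>l<L. sqrt d / 2 ^ (l + 2) * cell_discrepancy d (Suc l) \<nu>0 \<nu>1)"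
proof (induction L)
  case 0
  interpret \<nu>0: prob_space \<nu>0 by fact
  interpret \<nu>1: prob_space \<nu>1 by fact
  show ?case by (simp add: grid_0 \<nu>0.prob_space \<nu>1.prob_space)
next
  case (Suc L)
  \<comment> \<open>The increment depends on the fine cell only, because the cells are nested.\<close>
  define g where "g q = f (grid d (Suc L) q) - f (grid d L q)" for q
  have g_eq: "g (grid d (Suc L) x) = f (grid d (Suc L) x) - f (grid d L x)" for x
    by (simp add: g_def grid_coarsen grid_idem)
  have "(\<integral>x. f (grid d (Suc L) x) \<partial>\<nu>) = (\<integral>x. f (grid d L x) \<partial>\<nu>) + (\<integral>x. g (grid d (Suc L) x) \<partial>\<nu>)"
    if "prob_space \<nu>" "sets \<nu> = sets (unit_cube d)" for \<nu>
    unfolding g_eq using integral_comp_grid(1)[OF that, of f] by simp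
  note split = this[OF \<nu>0] this[OF \<nu>1]
  have "\<bar>g q\<bar> \<le> sqrt d / 2 ^ (L + 2)" for q
    unfolding g_def by (rule lipschitz_grid_step[OF f])
  then have "\<bar>(\<integral>x. g (grid d (Suc L) x) \<partial>\<nu>0) - (\<integral>x. g (grid d (Suc L) x) \<partial>\<nu>1)\<bar>
      \<le> sqrt d / 2 ^ (L + 2) * cell_discrepancy d (Suc L) \<nu>0 \<nu>1"
    by (rule integral_comp_grid_diff_le[OF \<nu>0 \<nu>1])
  with Suc show ?case unfolding split sum.lessThan_Suc by linarith
qed

lemma integral_lipschitz_grid_error:
  assumes f: "f \<in> lipschitz1_cube d" and \<nu>: "prob_space \<nu>" "sets \<nu> = sets (unit_cube d)"
  shows "\<bar>(\<integral>x. f x \<partial>\<nu>) - (\<integral>x. f (grid d L x) \<partial>\<nu>)\<bar> \<le> sqrt d / 2 ^ (L + 1)"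
proof -
  interpret prob_space \<nu> by fact
  note int = lipschitz_integrable[OF f \<nu>] integral_comp_grid(1)[OF \<nu>, of f L]
  have "\<bar>(\<integral>x. f x \<partial>\<nu>) - (\<integral>x. f (grid d L x) \<partial>\<nu>)\<bar> = \<bar>\<integral>x. f x - f (grid d L x) \<partial>\<nu>\<bar>"
    using int by simp
  also have "\<dots> \<le> (\<integral>x. \<bar>f x - f (grid d L x)\<bar> \<partial>\<nu>)"
    by (rule integral_abs_bound)
  also have "\<dots> \<le> (\<integral>x. sqrt d / 2 ^ (L + 1) \<partial>\<nu>)"
  proof (rule integral_mono)
    show "integrable \<nu> (\<lambda>x. \<bar>f x - f (grid d L x)\<bar>)" using int by simp
    fix x assume "x \<in> space \<nu>"
    then have "x \<in> space (unit_cube d)" using sets_eq_imp_space_eq[OF \<nu>(2)] by simp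
    then show "\<bar>f x - f (grid d L x)\<bar> \<le> sqrt d / 2 ^ (L + 1)" by (rule lipschitz_grid_error[OF f])
  qed simp
  finally show ?thesis by (simp add: prob_space)
qed

lemma integral_lipschitz_diff_le:
  assumes f: "f \<in> lipschitz1_cube d"
    and \<nu>0: "prob_space \<nu>0" "sets \<nu>0 = sets (unit_cube d)"
    and \<nu>1: "prob_space \<nu>1" "sets \<nu>1 = sets (unit_cube d)"
  shows "\<bar>(\<integral>x. f x \<partial>\<nu>0) - (\<integral>x. f x \<partial>\<nu>1)\<bar>
    \<le> sqrt d / 2 ^ L + (\<Sum>l<L. sqrt d / 2 ^ (l + 2) * cell_discrepancy d (Suc l) \<nu>0 \<nu>1)"
proof -
  have "sqrt d / 2 ^ L = sqrt d / 2 ^ (L + 1) + sqrt d / 2 ^ (L + 1)" by simp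
  then show ?thesis
    using integral_lipschitz_comp_grid_diff_le[OF assms, of L]
      integral_lipschitz_grid_error[OF f \<nu>0, of L] integral_lipschitz_grid_error[OF f \<nu>1, of L]
    by linarith
qed

lemma lipschitz1_cube_nonempty: "lipschitz1_cube d \<noteq> {}"
proof -
  have "(\<lambda>_. 0) \<in> lipschitz1_cube d"
    by (simp add: lipschitz1_cube_def euclidean_dist_def)
  then show ?thesis by blast
qed

text \<open>
  The bound on the transport distance that all dimensions share: the first term is what two
  roundings at level \<open>L\<close> can cost, and the right-hand side involves no test function any more.
\<close>

lemma W1_le_multiscale:
  assumes "prob_space \<nu>0" "sets \<nu>0 = sets (unit_cube d)"
    and "prob_space \<nu>1" "sets \<nu>1 = sets (unit_cube d)"
  shows "W1 d \<nu>0 \<nu>1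
    \<le> sqrt d / 2 ^ L + (\<Sum>l<L. sqrt d / 2 ^ (l + 2) * cell_discrepancy d (Suc l) \<nu>0 \<nu>1)"
  unfolding W1_def
  using integral_lipschitz_diff_le[OF _ assms] by (intro cSUP_least lipschitz1_cube_nonempty)

lemma integral_diff_le_W1:
  assumes "f \<in> lipschitz1_cube d"
    and "prob_space \<nu>0" "sets \<nu>0 = sets (unit_cube d)"
    and "prob_space \<nu>1" "sets \<nu>1 = sets (unit_cube d)"
  shows "\<bar>(\<integral>x. f x \<partial>\<nu>0) - (\<integral>x. f x \<partial>\<nu>1)\<bar> \<le> W1 d \<nu>0 \<nu>1"
  unfolding W1_def
  using integral_lipschitz_diff_le[OF _ assms(2-5), of _ 0]
  by (intro cSUP_upper[OF assms(1)] bdd_aboveI2) auto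

lemma W1_bounds:
  assumes \<nu>: "prob_space \<nu>0" "sets \<nu>0 = sets (unit_cube d)"
    "prob_space \<nu>1" "sets \<nu>1 = sets (unit_cube d)"
  shows "0 \<le> W1 d \<nu>0 \<nu>1" "W1 d \<nu>0 \<nu>1 \<le> sqrt d"
proof -
  obtain f where f: "f \<in> lipschitz1_cube d"
    using lipschitz1_cube_nonempty by blast
  from integral_diff_le_W1[OF f \<nu>] show "0 \<le> W1 d \<nu>0 \<nu>1" by linarith
  from W1_le_multiscale[OF \<nu>, of 0] show "W1 d \<nu>0 \<nu>1 \<le> sqrt d" by simp
qed

section \<open>Empirical measures and measurability\<close>

text \<open>
  Drawing a sample index uniformly at random gives access to the library results on image measures
  and uniform distributions.
\<close>

lemma empirical_measure_eq_distr:
  assumes n: "n \<ge> 1" and x: "\<And>k. x k \<in> space N"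
  shows "empirical_measure N n x = distr (measure_pmf (pmf_of_set {1..n})) N x"
proof (rule measure_eqI)
  fix A assume "A \<in> sets (empirical_measure N n x)"
  then have A: "A \<in> sets N" by simp
  have [measurable]: "x \<in> measurable (measure_pmf (pmf_of_set {1..n})) N"
    using x by simp
  have "emeasure (distr (measure_pmf (pmf_of_set {1..n})) N x) A =
      (\<integral>\<^sup>+y. indicator A y \<partial>distr (measure_pmf (pmf_of_set {1..n})) N x)"
    by (rule nn_integral_indicator[symmetric]) (use A in simp)
  also have "\<dots> = (\<integral>\<^sup>+k. indicator A (x k) \<partial>measure_pmf (pmf_of_set {1..n}))"
    using A x by (intro nn_integral_distr) simp_all
  also have "\<dots> = (\<Sum>k=1..n. indicator A (x k)) / of_nat n"
    using n by (subst nn_integral_pmf_of_set) simp_all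
  finally show "emeasure (empirical_measure N n x) A =
      emeasure (distr (measure_pmf (pmf_of_set {1..n})) N x) A"
    using A by (simp add: emeasure_empirical_measure)
qed simp

lemma empirical_measure_cong:
  assumes "\<And>k. k \<in> {1..n} \<Longrightarrow> x k = y k"
  shows "empirical_measure N n x = empirical_measure N n y"
  using assms unfolding empirical_measure_def by (simp cong: sum.cong_simp)

lemma prob_space_empirical_measure:
  assumes "n \<ge> 1" "\<And>k. x k \<in> space N"
  shows "prob_space (empirical_measure N n x)"
  unfolding empirical_measure_eq_distr[OF assms]
  using assms by (intro prob_space.prob_space_distr measure_pmf.prob_space_axioms) simp

lemma integral_empirical_measure:
  fixes f :: "'b \<Rightarrow> real"
  assumes n: "n \<ge> 1" and x: "\<And>k. x k \<in> space N" and f: "f \<in> borel_measurable N"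
  shows "(\<integral>y. f y \<partial>empirical_measure N n x) = (\<Sum>k=1..n. f (x k)) / n"
proof -
  have "(\<integral>y. f y \<partial>empirical_measure N n x) = (\<integral>k. f (x k) \<partial>measure_pmf (pmf_of_set {1..n}))"
    unfolding empirical_measure_eq_distr[OF n x] using x f by (intro integral_distr) simp_all
  also have "\<dots> = (\<Sum>k=1..n. f (x k)) / n"
    using n by (subst integral_pmf_of_set) simp_all
  finally show ?thesis .
qed

lemma measure_empirical_measure:
  assumes n: "n \<ge> 1" and x: "\<And>k. x k \<in> space N" and A: "A \<in> sets N"
  shows "measure (empirical_measure N n x) A = (\<Sum>k=1..n. indicator A (x k)) / n"
proof -
  have "measure (empirical_measure N n x) A = (\<integral>y. indicator A y \<partial>empirical_measure N n x)"
    using A sets.sets_into_space[OF A] by (simp add: Int_absorb2)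
  also have "\<dots> = (\<Sum>k=1..n. indicator A (x k)) / n"
    by (rule integral_empirical_measure[OF n x]) (use A in simp)
  finally show ?thesis .
qed

lemma W1_le_add:
  assumes \<nu>: "prob_space \<nu>" "sets \<nu> = sets (unit_cube d)"
    and \<nu>': "prob_space \<nu>'" "sets \<nu>' = sets (unit_cube d)"
    and \<mu>: "prob_space \<mu>" "sets \<mu> = sets (unit_cube d)"
    and close: "\<And>f. f \<in> lipschitz1_cube d \<Longrightarrow> \<bar>(\<integral>x. f x \<partial>\<nu>) - (\<integral>x. f x \<partial>\<nu>')\<bar> \<le> e"
  shows "W1 d \<nu> \<mu> \<le> W1 d \<nu>' \<mu> + e"
proof -
  have "\<bar>(\<integral>x. f x \<partial>\<nu>) - (\<integral>x. f x \<partial>\<mu>)\<bar> \<le> W1 d \<nu>' \<mu> + e" if "f \<in> lipschitz1_cube d" for f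
    using close[OF that] integral_diff_le_W1[OF that \<nu>' \<mu>] by linarith
  then show ?thesis
    unfolding W1_def[of d \<nu> \<mu>] by (intro cSUP_least lipschitz1_cube_nonempty)
qed

text \<open>
  Rounding moves each sample point, and hence the empirical measure, by at most half the diameter of
  a cell. This reduces the measurability of the distance, a supremum over an uncountable family, to
  that of a function of finitely many values.
\<close>

lemma W1_empirical_grid_error:
  assumes \<mu>: "prob_space \<mu>" "sets \<mu> = sets (unit_cube d)"
    and n: "n \<ge> 1" and x: "\<And>k. x k \<in> space \<mu>"
  shows "\<bar>W1 d (empirical_measure \<mu> n (\<lambda>k. grid d l (x k))) \<mu> - W1 d (empirical_measure \<mu> n x) \<mu>\<bar>
    \<le> sqrt d / 2 ^ (l + 1)"
proof -
  let ?g = "\<lambda>k. grid d l (x k)"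
  have space: "space \<mu> = space (unit_cube d)"
    by (rule sets_eq_imp_space_eq[OF \<mu>(2)])
  have g: "?g k \<in> space \<mu>" for k
    unfolding space by (rule grid_in_cube)
  have close: "\<bar>(\<integral>y. f y \<partial>empirical_measure \<mu> n ?g) - (\<integral>y. f y \<partial>empirical_measure \<mu> n x)\<bar>
      \<le> sqrt d / 2 ^ (l + 1)" if f: "f \<in> lipschitz1_cube d" for f
  proof -
    have f_meas: "f \<in> borel_measurable \<mu>"
      using lipschitz_measurable[OF f] measurable_cong_sets[OF \<mu>(2) refl] by blast
    have "\<bar>(\<Sum>k=1..n. f (?g k)) - (\<Sum>k=1..n. f (x k))\<bar> \<le> (\<Sum>k=1..n. \<bar>f (?g k) - f (x k)\<bar>)"
      unfolding sum_subtractf[symmetric] by (rule sum_abs)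
    also have "\<dots> \<le> (\<Sum>k=1..n. sqrt d / 2 ^ (l + 1))"
    proof (rule sum_mono)
      fix k
      have "x k \<in> space (unit_cube d)" using x space by simp
      from lipschitz_grid_error[OF f this, of l]
      show "\<bar>f (?g k) - f (x k)\<bar> \<le> sqrt d / 2 ^ (l + 1)" by linarith
    qed
    finally show ?thesis
      unfolding integral_empirical_measure[OF n g f_meas] integral_empirical_measure[OF n x f_meas]
        diff_divide_distrib[symmetric] abs_divide
      using n by (simp add: pos_divide_le_eq mult.commute)
  qed
  then have close': "\<bar>(\<integral>y. f y \<partial>empirical_measure \<mu> n x) - (\<integral>y. f y \<partial>empirical_measure \<mu> n ?g)\<bar>
      \<le> sqrt d / 2 ^ (l + 1)" if "f \<in> lipschitz1_cube d" for f
    by (subst abs_minus_commute) (rule close[OF that])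
  have emp: "prob_space (empirical_measure \<mu> n y)" "sets (empirical_measure \<mu> n y) = sets (unit_cube d)"
    if "\<And>k. y k \<in> space \<mu>" for y
    using prob_space_empirical_measure[OF n that] \<mu>(2) by simp_all
  show ?thesis
    using W1_le_add[OF emp[of ?g, OF g] emp[of x, OF x] \<mu> close]
      W1_le_add[OF emp[of x, OF x] emp[of ?g, OF g] \<mu> close']
    by linarith
qed

lemma measurable_W1_empirical_grid:
  assumes \<mu>: "sets \<mu> = sets (unit_cube d)" and X: "\<And>k. X k \<in> measurable M \<mu>"
  shows "(\<lambda>\<omega>. W1 d (empirical_measure \<mu> n (\<lambda>k. grid d l (X k \<omega>))) \<mu>) \<in> borel_measurable M"
proof -
  let ?S = "{1..n} \<rightarrow>\<^sub>E grid_points d l"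
  let ?T = "\<lambda>\<omega>. \<lambda>k\<in>{1..n}. grid d l (X k \<omega>)"
  have grid_X: "(\<lambda>\<omega>. grid d l (X k \<omega>)) \<in> measurable M (count_space (grid_points d l))" for k
    using X[of k] measurable_grid[of d l] measurable_cong_sets[OF refl \<mu>, of M]
    by (auto intro: measurable_compose)
  \<comment> \<open>The tuple of rounded sample points takes finitely many values, so that any function of it is measurable.\<close>
  have "?T \<in> measurable M (count_space ?S)"
  proof (subst measurable_count_space_eq2, simp add: finite_PiE, intro conjI ballI)
    show "?T \<in> space M \<rightarrow> ?S" using grid_in_grid_points by (simp add: restrict_PiE_iff)
    fix a assume a: "a \<in> ?S"
    have "?T -` {a} \<inter> space M = {\<omega> \<in> space M. \<forall>k\<in>{1..n}. grid d l (X k \<omega>) = a k}"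
      using a by (auto simp: fun_eq_iff PiE_def extensional_def)
    also have "\<dots> \<in> sets M"
    proof (rule sets.sets_Collect_finite_All)
      fix k assume "k \<in> {1..n}"
      then have "{a k} \<in> sets (count_space (grid_points d l))" using a by auto
      from measurable_sets[OF grid_X this]
      show "{\<omega> \<in> space M. grid d l (X k \<omega>) = a k} \<in> sets M"
        by (simp add: vimage_def Int_def conj_commute)
    qed simp
    finally show "?T -` {a} \<inter> space M \<in> sets M" .
  qed
  then have "(\<lambda>\<omega>. W1 d (empirical_measure \<mu> n (?T \<omega>)) \<mu>) \<in> borel_measurable M"
    by (rule measurable_compose) simp
  moreover have "empirical_measure \<mu> n (?T \<omega>) = empirical_measure \<mu> n (\<lambda>k. grid d l (X k \<omega>))" for \<omega>
    by (rule empirical_measure_cong) simp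
  ultimately show ?thesis by simp
qed

lemma measurable_W1_empirical:
  assumes \<mu>: "prob_space \<mu>" "sets \<mu> = sets (unit_cube d)"
    and n: "n \<ge> 1" and X: "\<And>k. X k \<in> measurable M \<mu>"
  shows "(\<lambda>\<omega>. W1 d (empirical_measure \<mu> n (\<lambda>k. X k \<omega>)) \<mu>) \<in> borel_measurable M"
proof (rule borel_measurable_LIMSEQ_real)
  let ?W = "\<lambda>l \<omega>. W1 d (empirical_measure \<mu> n (\<lambda>k. grid d l (X k \<omega>))) \<mu>"
  show "?W l \<in> borel_measurable M" for l
    by (rule measurable_W1_empirical_grid[OF \<mu>(2) X])
  fix \<omega> assume "\<omega> \<in> space M"
  then have x: "X k \<omega> \<in> space \<mu>" for k
    using measurable_space[OF X] by blast
  have "(\<lambda>l. sqrt d / 2 ^ (l + 1)) \<longlonglongrightarrow> 0"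
    using LIMSEQ_divide_realpow_zero[of 2 "sqrt d"] by (intro LIMSEQ_ignore_initial_segment) simp
  then have "(\<lambda>l. ?W l \<omega> - W1 d (empirical_measure \<mu> n (\<lambda>k. X k \<omega>)) \<mu>) \<longlonglongrightarrow> 0"
    by (rule Lim_null_comparison[rotated])
      (use W1_empirical_grid_error[OF \<mu> n x] in simp)
  then show "(\<lambda>l. ?W l \<omega>) \<longlonglongrightarrow> W1 d (empirical_measure \<mu> n (\<lambda>k. X k \<omega>)) \<mu>"
    by (rule LIM_zero_cancel)
qed

section \<open>Expected discrepancy of an i.i.d. sample\<close>

lemma iid_sequence_measurable:
  assumes "iid_sequence M \<mu> X"
  shows "X k \<in> measurable M \<mu>"
proof -
  interpret prob_space M using assms by (simp add: iid_sequence_def)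
  show ?thesis using assms unfolding iid_sequence_def indep_vars_def2 by blast
qed

text \<open>
  For independent centred variables the mixed terms of the square have mean zero.
\<close>

lemma iid_sum_second_moment:
  fixes g :: "'b \<Rightarrow> real"
  assumes iid: "iid_sequence M \<mu> X"
    and g: "g \<in> borel_measurable \<mu>" "\<And>y. \<bar>g y\<bar> \<le> B" "(\<integral>y. g y \<partial>\<mu>) = 0"
  shows "integrable M (\<lambda>\<omega>. (\<Sum>k=1..n. g (X k \<omega>))\<^sup>2)"
    and "(\<integral>\<omega>. (\<Sum>k=1..n. g (X k \<omega>))\<^sup>2 \<partial>M) = n * (\<integral>y. (g y)\<^sup>2 \<partial>\<mu>)"
proof -
  interpret prob_space M using iid by (simp add: iid_sequence_def)
  note X = iid_sequence_measurable[OF iid]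
  have gX [measurable]: "(\<lambda>\<omega>. g (X k \<omega>)) \<in> borel_measurable M" for k
    by (rule measurable_compose[OF X g(1)])
  have transfer: "(\<integral>\<omega>. h (X k \<omega>) \<partial>M) = (\<integral>y. h y \<partial>\<mu>)" if "h \<in> borel_measurable \<mu>" for h :: "'b \<Rightarrow> real" and k
    using integral_distr[OF X that, of k] iid by (simp add: iid_sequence_def)
  have int_g: "integrable M (\<lambda>\<omega>. g (X k \<omega>))" for k
    using g(2) by (intro integrable_const_bound[of _ B]) simp_all
  have "\<bar>g y * g z\<bar> \<le> B * B" for y z
    unfolding abs_mult using g(2) by (intro mult_mono) (auto intro: order_trans[OF abs_ge_zero])
  then have int: "integrable M (\<lambda>\<omega>. g (X i \<omega>) * g (X j \<omega>))" for i j
    by (intro integrable_const_bound[of _ "B * B"]) simp_all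
  have indep: "indep_vars (\<lambda>_. borel) (\<lambda>k \<omega>. g (X k \<omega>)) UNIV"
    by (rule indep_vars_compose2[of "\<lambda>_. \<mu>"]) (use iid g(1) in \<open>simp_all add: iid_sequence_def\<close>)
  have cov: "(\<integral>\<omega>. g (X i \<omega>) * g (X j \<omega>) \<partial>M) = (if i = j then \<integral>y. (g y)\<^sup>2 \<partial>\<mu> else 0)" for i j
  proof (cases "i = j")
    case True
    then show ?thesis
      using transfer[of "\<lambda>y. (g y)\<^sup>2" i] g(1) by (simp add: power2_eq_square)
  next
    case False
    have "(\<integral>\<omega>. (\<Prod>k\<in>{i, j}. g (X k \<omega>)) \<partial>M) = (\<Prod>k\<in>{i, j}. \<integral>\<omega>. g (X k \<omega>) \<partial>M)"
      by (intro indep_vars_lebesgue_integral indep_vars_subset[OF indep] int_g) simp_all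
    then show ?thesis
      using False transfer[OF g(1)] g(3) by simp
  qed
  have square: "(\<Sum>k=1..n. g (X k \<omega>))\<^sup>2 = (\<Sum>i=1..n. \<Sum>j=1..n. g (X i \<omega>) * g (X j \<omega>))" for \<omega>
    by (simp add: power2_eq_square sum_product)
  show "integrable M (\<lambda>\<omega>. (\<Sum>k=1..n. g (X k \<omega>))\<^sup>2)"
    unfolding square using int by (intro Bochner_Integration.integrable_sum)
  have "(\<integral>\<omega>. (\<Sum>k=1..n. g (X k \<omega>))\<^sup>2 \<partial>M) = (\<Sum>i=1..n. \<Sum>j=1..n. \<integral>\<omega>. g (X i \<omega>) * g (X j \<omega>) \<partial>M)"
    unfolding square using int
    by (simp add: Bochner_Integration.integral_sum Bochner_Integration.integrable_sum)
  also have "\<dots> = n * (\<integral>y. (g y)\<^sup>2 \<partial>\<mu>)"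
    unfolding cov by (simp add: sum.delta)
  finally show "(\<integral>\<omega>. (\<Sum>k=1..n. g (X k \<omega>))\<^sup>2 \<partial>M) = n * (\<integral>y. (g y)\<^sup>2 \<partial>\<mu>)" .
qed

text \<open>
  Jensen's inequality would bound the mean deviation by \<open>sqrt (measure \<mu> A / n)\<close>. The inequality
  \<open>2 * y \<le> a * y\<^sup>2 + 1 / a\<close> linearises this bound with a parameter \<open>a\<close>; a common choice of \<open>a\<close> for all
  cells of a level then replaces the Cauchy-Schwarz inequality over the cells.
\<close>

lemma expected_frequency_deviation:
  fixes \<mu> :: "'b measure"
  assumes \<mu>: "prob_space \<mu>" and iid: "iid_sequence M \<mu> X"
    and n: "n \<ge> 1" and A: "A \<in> sets \<mu>" and a: "a > 0"
  shows "integrable M (\<lambda>\<omega>. \<bar>measure (empirical_measure \<mu> n (\<lambda>k. X k \<omega>)) A - measure \<mu> A\<bar>)" (is "integrable M ?D")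
    and "(\<integral>\<omega>. \<bar>measure (empirical_measure \<mu> n (\<lambda>k. X k \<omega>)) A - measure \<mu> A\<bar> \<partial>M)
      \<le> (a * measure \<mu> A / n + 1 / a) / 2"
proof -
  interpret prob_space M using iid by (simp add: iid_sequence_def)
  interpret \<mu>: prob_space \<mu> by fact
  note X [measurable] = iid_sequence_measurable[OF iid]
  note A [measurable]
  define p where "p = measure \<mu> A"
  define g where "g y = indicator A y - p" for y :: 'b
  define S where "S \<omega> = (\<Sum>k=1..n. g (X k \<omega>))" for \<omega>
  have p: "0 \<le> p" "p \<le> 1" by (simp_all add: p_def)
  have g_meas: "g \<in> borel_measurable \<mu>" unfolding g_def by measurable
  have int_A: "integrable \<mu> (indicator A :: _ \<Rightarrow> real)" "(\<integral>y. indicator A y \<partial>\<mu>) = p"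
    using sets.Int_space_eq2[OF A] by (simp_all add: integrable_real_indicator less_top[symmetric] p_def)
  have g_bound: "\<bar>g y\<bar> \<le> 1" for y
    using p by (simp add: g_def indicator_def)
  have g_mean: "(\<integral>y. g y \<partial>\<mu>) = 0"
    unfolding g_def using int_A by (simp add: \<mu>.prob_space)
  have "(\<integral>y. (g y)\<^sup>2 \<partial>\<mu>) = (\<integral>y. (1 - 2 * p) * indicator A y + p\<^sup>2 \<partial>\<mu>)"
    by (intro Bochner_Integration.integral_cong refl) (simp add: g_def indicator_def power2_eq_square algebra_simps)
  also have "\<dots> = (1 - 2 * p) * p + p\<^sup>2"
    using int_A by (simp add: \<mu>.prob_space)
  also have "\<dots> \<le> p" by (simp add: power2_eq_square algebra_simps)
  finally have g_var: "(\<integral>y. (g y)\<^sup>2 \<partial>\<mu>) \<le> p" .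
  note S2 = iid_sum_second_moment[OF iid g_meas g_bound g_mean, of n, folded S_def]
  have D_eq: "?D \<omega> = \<bar>S \<omega>\<bar> / n" if "\<omega> \<in> space M" for \<omega>
  proof -
    have x: "X k \<omega> \<in> space \<mu>" for k using measurable_space[OF X that] .
    have "S \<omega> = (\<Sum>k=1..n. indicator A (X k \<omega>)) - n * p"
      by (simp add: S_def g_def sum_subtractf)
    then show ?thesis
      using n by (simp add: measure_empirical_measure[OF n x A] p_def[symmetric] field_simps abs_divide[symmetric])
  qed
  have S_meas [measurable]: "S \<in> borel_measurable M"
    unfolding S_def using measurable_compose[OF X g_meas] by (intro borel_measurable_sum)
  have "\<bar>S \<omega>\<bar> \<le> n" for \<omega>
  proof -
    have "\<bar>S \<omega>\<bar> \<le> (\<Sum>k=1..n. \<bar>g (X k \<omega>)\<bar>)" unfolding S_def by (rule sum_abs)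
    also have "\<dots> \<le> (\<Sum>k=1..n. 1)" by (rule sum_mono) (rule g_bound)
    finally show ?thesis by simp
  qed
  then have int_S: "integrable M (\<lambda>\<omega>. \<bar>S \<omega>\<bar> / n)"
    using n by (intro integrable_const_bound[of _ 1]) simp_all
  show "integrable M ?D"
    using int_S by (subst Bochner_Integration.integrable_cong[OF refl D_eq])
  have young: "\<bar>S \<omega>\<bar> / n \<le> (a / n\<^sup>2 * (S \<omega>)\<^sup>2 + 1 / a) / 2" for \<omega>
  proof -
    have "0 \<le> (a * (\<bar>S \<omega>\<bar> / n) - 1)\<^sup>2 / a" using a by simp
    also have "\<dots> = a / n\<^sup>2 * (S \<omega>)\<^sup>2 - 2 * (\<bar>S \<omega>\<bar> / n) + 1 / a"
      using a n by (simp add: power2_diff power_mult_distrib power_divide field_simps power2_eq_square)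
    finally show ?thesis by simp
  qed
  have "(\<integral>\<omega>. ?D \<omega> \<partial>M) = (\<integral>\<omega>. \<bar>S \<omega>\<bar> / n \<partial>M)"
    by (rule Bochner_Integration.integral_cong[OF refl D_eq])
  also have "\<dots> \<le> (\<integral>\<omega>. (a / n\<^sup>2 * (S \<omega>)\<^sup>2 + 1 / a) / 2 \<partial>M)"
    using S2(1) by (intro integral_mono int_S young) simp
  also have "\<dots> = (a / n\<^sup>2 * (n * (\<integral>y. (g y)\<^sup>2 \<partial>\<mu>)) + 1 / a) / 2"
    using S2 by (simp add: prob_space)
  also have "\<dots> \<le> (a / n\<^sup>2 * (n * p) + 1 / a) / 2"
    using g_var a by (intro divide_right_mono add_right_mono mult_left_mono) simp_all
  also have "\<dots> = (a * p / n + 1 / a) / 2"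
    using n by (simp add: power2_eq_square)
  finally show "(\<integral>\<omega>. ?D \<omega> \<partial>M) \<le> (a * measure \<mu> A / n + 1 / a) / 2"
    by (simp add: p_def)
qed

text \<open>
  Summing the deviations over at most \<open>2 ^ (d * l)\<close> cells of total mass one. The bound does not
  depend on how \<open>\<mu>\<close> is spread over the cells.
\<close>

lemma expected_cell_discrepancy:
  assumes \<mu>: "prob_space \<mu>" "sets \<mu> = sets (unit_cube d)"
    and iid: "iid_sequence M \<mu> X" and n: "n \<ge> 1"
  shows "integrable M (\<lambda>\<omega>. cell_discrepancy d l (empirical_measure \<mu> n (\<lambda>k. X k \<omega>)) \<mu>)"
    and "(\<integral>\<omega>. cell_discrepancy d l (empirical_measure \<mu> n (\<lambda>k. X k \<omega>)) \<mu> \<partial>M) \<le> sqrt (2 ^ (d * l) / n)"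
proof -
  interpret \<mu>: prob_space \<mu> by (rule \<mu>(1))
  define N :: real where "N = 2 ^ (d * l)"
  \<comment> \<open>This choice balances the two terms \<open>a / n\<close> and \<open>N / a\<close> below.\<close>
  define a where "a = sqrt (N * n)"
  have N: "N > 0" by (simp add: N_def)
  then have a: "a > 0" using n by (simp add: a_def)
  have cells: "cell d l q \<in> sets \<mu>" for q using cell_sets \<mu>(2) by simp
  note dev = expected_frequency_deviation[OF \<mu>(1) iid n cells a]
  show "integrable M (\<lambda>\<omega>. cell_discrepancy d l (empirical_measure \<mu> n (\<lambda>k. X k \<omega>)) \<mu>)"
    unfolding cell_discrepancy_def by (rule Bochner_Integration.integrable_sum) (rule dev(1))
  have total: "(\<Sum>q\<in>grid_points d l. measure \<mu> (cell d l q)) = 1"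
    using integral_comp_grid(2)[OF \<mu>, of "\<lambda>_. 1"] by (simp add: \<mu>.prob_space)
  have card: "card (grid_points d l) \<le> N"
    using of_nat_mono[OF card_grid_points_le[of d l], where 'a = real] by (simp add: N_def)
  have "(\<integral>\<omega>. cell_discrepancy d l (empirical_measure \<mu> n (\<lambda>k. X k \<omega>)) \<mu> \<partial>M) =
      (\<Sum>q\<in>grid_points d l.
        \<integral>\<omega>. \<bar>measure (empirical_measure \<mu> n (\<lambda>k. X k \<omega>)) (cell d l q) - measure \<mu> (cell d l q)\<bar> \<partial>M)"
    unfolding cell_discrepancy_def by (rule Bochner_Integration.integral_sum) (rule dev(1))
  also have "\<dots> \<le> (\<Sum>q\<in>grid_points d l. (a * measure \<mu> (cell d l q) / n + 1 / a) / 2)"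
    by (rule sum_mono) (rule dev(2))
  also have "\<dots> = (a / n * (\<Sum>q\<in>grid_points d l. measure \<mu> (cell d l q)) + card (grid_points d l) / a) / 2"
    by (simp add: sum_divide_distrib[symmetric] sum.distrib sum_distrib_left)
  also have "\<dots> \<le> (a / n + N / a) / 2"
    unfolding total using card a by (simp add: divide_right_mono)
  also have "\<dots> = sqrt (N / n)"
  proof -
    have "a / n = sqrt (N / n)" "N / a = sqrt (N / n)"
      using N n unfolding a_def by (simp_all add: real_sqrt_mult real_sqrt_divide divide_eq_eq eq_divide_eq)
    then show ?thesis by simp
  qed
  finally show "(\<integral>\<omega>. cell_discrepancy d l (empirical_measure \<mu> n (\<lambda>k. X k \<omega>)) \<mu> \<partial>M) \<le> sqrt (2 ^ (d * l) / n)"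
    by (simp add: N_def)
qed

lemma expected_W1_le_multiscale:
  assumes \<mu>: "prob_space \<mu>" "sets \<mu> = sets (unit_cube d)"
    and iid: "iid_sequence M \<mu> X" and n: "n \<ge> 1"
  shows "integrable M (\<lambda>\<omega>. W1 d (empirical_measure \<mu> n (\<lambda>k. X k \<omega>)) \<mu>)"
    and "(\<integral>\<omega>. W1 d (empirical_measure \<mu> n (\<lambda>k. X k \<omega>)) \<mu> \<partial>M)
      \<le> sqrt d / 2 ^ L + (\<Sum>l<L. sqrt d / 2 ^ (l + 2) * sqrt (2 ^ (d * Suc l) / n))"
proof -
  interpret prob_space M using iid by (simp add: iid_sequence_def)
  let ?e = "\<lambda>\<omega>. empirical_measure \<mu> n (\<lambda>k. X k \<omega>)"
  note X = iid_sequence_measurable[OF iid]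
  have emp: "prob_space (?e \<omega>)" "sets (?e \<omega>) = sets (unit_cube d)" if "\<omega> \<in> space M" for \<omega>
    using prob_space_empirical_measure[OF n measurable_space[OF X that]] \<mu>(2) by simp_all
  show int: "integrable M (\<lambda>\<omega>. W1 d (?e \<omega>) \<mu>)"
  proof (rule integrable_const_bound)
    show "AE \<omega> in M. norm (W1 d (?e \<omega>) \<mu>) \<le> sqrt d"
      using W1_bounds[OF emp \<mu>] by (intro AE_I2) simp
  qed (rule measurable_W1_empirical[OF \<mu> n X])
  note disc = expected_cell_discrepancy[OF \<mu> iid n]
  have "(\<integral>\<omega>. W1 d (?e \<omega>) \<mu> \<partial>M)
      \<le> (\<integral>\<omega>. sqrt d / 2 ^ L + (\<Sum>l<L. sqrt d / 2 ^ (l + 2) * cell_discrepancy d (Suc l) (?e \<omega>) \<mu>) \<partial>M)"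
  proof (rule integral_mono[OF int])
    show "integrable M (\<lambda>\<omega>. sqrt d / 2 ^ L + (\<Sum>l<L. sqrt d / 2 ^ (l + 2) * cell_discrepancy d (Suc l) (?e \<omega>) \<mu>))"
      using disc(1) by (intro Bochner_Integration.integrable_add Bochner_Integration.integrable_sum
          integrable_mult_right integrable_const)
  qed (rule W1_le_multiscale[OF emp \<mu>])
  also have "\<dots> = sqrt d / 2 ^ L + (\<Sum>l<L. sqrt d / 2 ^ (l + 2) * (\<integral>\<omega>. cell_discrepancy d (Suc l) (?e \<omega>) \<mu> \<partial>M))"
    using disc(1) by (simp add: prob_space)
  also have "\<dots> \<le> sqrt d / 2 ^ L + (\<Sum>l<L. sqrt d / 2 ^ (l + 2) * sqrt (2 ^ (d * Suc l) / n))"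
    by (intro add_left_mono sum_mono mult_left_mono disc(2)) simp
  finally show "(\<integral>\<omega>. W1 d (?e \<omega>) \<mu> \<partial>M)
      \<le> sqrt d / 2 ^ L + (\<Sum>l<L. sqrt d / 2 ^ (l + 2) * sqrt (2 ^ (d * Suc l) / n))" .
qed

section \<open>The bound in each dimension\<close>

text \<open>
  Passing to the next finer level doubles the precision, but multiplies the number of cells by
  \<open>2 ^ d\<close> and hence the bound on the expected discrepancy by \<open>sqrt 2 ^ d\<close>. The contributions of the levels thus form
  a geometric progression, which decreases for \<open>d = 1\<close>, is constant for \<open>d = 2\<close> and increases for
  \<open>d \<ge> 3\<close>.
\<close>

definition scale_ratio :: "nat \<Rightarrow> real" where
  "scale_ratio d = sqrt 2 ^ d / 2"

lemma expected_W1_le_geometric: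
  assumes \<mu>: "prob_space \<mu>" "sets \<mu> = sets (unit_cube d)"
    and iid: "iid_sequence M \<mu> X" and n: "n \<ge> 1"
  shows "(\<integral>\<omega>. W1 d (empirical_measure \<mu> n (\<lambda>k. X k \<omega>)) \<mu> \<partial>M)
    \<le> sqrt d * (1 / 2 ^ L + (\<Sum>l<L. scale_ratio d ^ Suc l) / (2 * sqrt n))"
proof -
  have "sqrt d / 2 ^ (l + 2) * sqrt (2 ^ (d * Suc l) / n) = sqrt d * (scale_ratio d ^ Suc l / (2 * sqrt n))" for l
    by (simp only: scale_ratio_def real_sqrt_divide real_sqrt_power power_mult power_divide) simp
  then show ?thesis
    using expected_W1_le_multiscale(2)[OF \<mu> iid n, of L]
    by (simp only: distrib_left sum_distrib_left sum_divide_distrib) simp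
qed

text \<open>
  The geometric series converges, so that the number of levels can tend to infinity.
\<close>

lemma expected_W1_dim_1:
  assumes \<mu>: "prob_space \<mu>" "sets \<mu> = sets (unit_cube 1)"
    and iid: "iid_sequence M \<mu> X" and n: "n \<ge> 1"
  shows "(\<integral>\<omega>. W1 1 (empirical_measure \<mu> n (\<lambda>k. X k \<omega>)) \<mu> \<partial>M)
    \<le> 1 / (2 * (sqrt 2 - 1)) * (1 / sqrt n)" (is "?E \<le> ?c")
proof (rule LIMSEQ_le_const)
  have "(\<lambda>L. (1::real) / 2 ^ L) \<longlonglongrightarrow> 0"
    by (rule LIMSEQ_divide_realpow_zero) simp
  from tendsto_add[OF this tendsto_const[of ?c]]
  show "(\<lambda>L. 1 / 2 ^ L + ?c) \<longlonglongrightarrow> ?c" by simp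
  have s: "sqrt 2 > (1::real)" by simp
  define r where "r = scale_ratio 1"
  have r: "0 \<le> r" "r < 1" "r / (1 - r) = 1 / (sqrt 2 - 1)"
  proof -
    have "sqrt 2 < (2::real)" by (rule real_less_lsqrt) simp_all
    then show "0 \<le> r" and r_less: "r < 1" by (simp_all add: r_def scale_ratio_def)
    have "r * sqrt 2 = 1"
      by (simp add: r_def scale_ratio_def)
    then have "r * (sqrt 2 - 1) = 1 - r" by (simp add: right_diff_distrib)
    then show "r / (1 - r) = 1 / (sqrt 2 - 1)"
      using s r_less by (simp add: frac_eq_eq)
  qed
  have "?E \<le> 1 / 2 ^ L + ?c" for L
  proof -
    have "(\<Sum>l<L. r ^ Suc l) = r * ((1 - r ^ L) / (1 - r))"
      using r by (simp add: sum_distrib_left[symmetric] sum_gp_strict)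
    also have "\<dots> \<le> r * (1 / (1 - r))"
      using r by (intro mult_left_mono divide_right_mono) simp_all
    finally have "(\<Sum>l<L. r ^ Suc l) \<le> 1 / (sqrt 2 - 1)"
      using r by simp
    then have "(\<Sum>l<L. r ^ Suc l) / (2 * sqrt n) \<le> 1 / (sqrt 2 - 1) / (2 * sqrt n)"
      by (rule divide_right_mono) simp
    also have "\<dots> = ?c" by simp
    finally show ?thesis
      using expected_W1_le_geometric[OF \<mu> iid n, of L] by (simp add: r_def)
  qed
  then show "\<exists>N. \<forall>L\<ge>N. ?E \<le> 1 / 2 ^ L + ?c" by blast
qed

text \<open>
  All levels contribute equally. About \<open>log 2 n / 2\<close> of them bring the rounding error down to the order
  \<open>1 / sqrt n\<close> of one contribution.
\<close>

lemma expected_W1_dim_2: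
  assumes \<mu>: "prob_space \<mu>" "sets \<mu> = sets (unit_cube 2)"
    and iid: "iid_sequence M \<mu> X" and n: "n \<ge> 1"
  shows "(\<integral>\<omega>. W1 2 (empirical_measure \<mu> n (\<lambda>k. X k \<omega>)) \<mu> \<partial>M)
    \<le> (log 2 n + 8) / sqrt (8 * n)" (is "?E \<le> _")
proof -
  define s where "s = log 2 n"
  have s: "0 \<le> s" using n by (simp add: s_def)
  define L where "L = nat \<lceil>s / 2\<rceil>"
  have L: "s / 2 \<le> L" "L \<le> s / 2 + 1" using s by (auto simp: L_def)
  have "sqrt n = (2 powr s) powr (1 / 2)"
    using n by (simp add: s_def powr_half_sqrt)
  also have "\<dots> = 2 powr (s / 2)" by (simp add: powr_powr)
  also have "\<dots> \<le> 2 powr L" using L by simp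
  finally have pow: "sqrt n \<le> 2 ^ L" by (simp add: powr_realpow)
  have "1 / 2 ^ L \<le> 1 / sqrt n"
    using pow n by (intro divide_left_mono) simp_all
  moreover have "L / (2 * sqrt n) \<le> (s / 2 + 1) / (2 * sqrt n)"
    using L by (intro divide_right_mono) simp_all
  moreover have "?E \<le> sqrt 2 * (1 / 2 ^ L + L / (2 * sqrt n))"
    using expected_W1_le_geometric[OF \<mu> iid n, of L] by (simp add: scale_ratio_def)
  ultimately have "?E \<le> sqrt 2 * (1 / sqrt n + (s / 2 + 1) / (2 * sqrt n))"
    by (meson add_mono mult_left_mono order_trans real_sqrt_ge_zero zero_le_numeral)
  also have "1 / sqrt n + (s / 2 + 1) / (2 * sqrt n) = (s + 6) / (4 * sqrt n)"
    using n by (simp add: field_simps)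
  also have "sqrt 2 * ((s + 6) / (4 * sqrt n)) \<le> sqrt 2 * ((s + 8) / (4 * sqrt n))"
    by (intro divide_right_mono mult_left_mono) simp_all
  also have "\<dots> = (s + 8) / (2 * sqrt 2 * sqrt n)"
  proof -
    have four: "4 = sqrt 2 * (2 * sqrt (2::real))" by simp
    show ?thesis
      by (simp only: four mult.assoc times_divide_eq_right) (rule mult_divide_mult_cancel_left, simp)
  qed
  also have "2 * sqrt 2 = sqrt (8::real)"
    using real_sqrt_mult[of 4 2] by simp
  finally show ?thesis by (simp add: s_def real_sqrt_mult)
qed

text \<open>
  The second factor bounds \<open>2 powr t + r / (2 * (r - 1)) * (1 / r) powr t\<close> for \<open>r = scale_ratio d\<close> and
  all \<open>0 \<le> t \<le> 1\<close>; it is the value at \<open>t = 1\<close>. The number \<open>t\<close> is what is lost when the number of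
  levels is rounded to an integer.
\<close>

definition W1_const :: "nat \<Rightarrow> real" where
  "W1_const d = sqrt d * (2 + 1 / (2 * (scale_ratio d - 1)))"

lemma one_less_scale_ratio:
  assumes "d \<ge> 3"
  shows "1 < scale_ratio d"
proof -
  have "sqrt 2 ^ 3 \<le> sqrt 2 ^ d" using assms by (intro power_increasing) simp_all
  moreover have "sqrt 2 ^ 3 = 2 * sqrt (2::real)" by (simp add: power3_eq_cube)
  moreover have "1 < sqrt (2::real)" by simp
  ultimately have "2 < sqrt 2 ^ d" by linarith
  then show ?thesis by (simp add: scale_ratio_def)
qed

text \<open>
  The finest level dominates. The two contributions balance when a cell has side length about
  \<open>1 / n powr (1 / d)\<close>, which asks for \<open>s = log 2 n / d\<close> levels. Rounding \<open>s\<close> down to the integer \<open>s - t\<close>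
  costs a factor \<open>2 powr t\<close> in the rounding error and gains a factor \<open>r powr t\<close> in the stochastic
  error, where \<open>r\<close> is the ratio of the geometric progression. Estimating these factors separately by
  their extreme values would give \<open>5 / 2\<close> instead of \<open>2\<close> as the limit of the constants; convexity in \<open>t\<close>
  allows to interpolate linearly between \<open>t = 0\<close> and \<open>t = 1\<close>, and \<open>t = 1\<close> turns out to be the worse
  end.
\<close>

lemma expected_W1_dim_ge_3:
  assumes \<mu>: "prob_space \<mu>" "sets \<mu> = sets (unit_cube d)"
    and iid: "iid_sequence M \<mu> X" and n: "n \<ge> 1" and d: "d \<ge> 3"
  shows "(\<integral>\<omega>. W1 d (empirical_measure \<mu> n (\<lambda>k. X k \<omega>)) \<mu> \<partial>M)
    \<le> W1_const d / n powr (1 / d)" (is "?E \<le> _")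
proof -
  define r where "r = scale_ratio d"
  have r: "1 < r" unfolding r_def by (rule one_less_scale_ratio[OF d])
  have r_powr: "r = 2 powr (d / 2 - 1)"
    by (simp add: r_def scale_ratio_def powr_diff powr_realpow[symmetric] powr_powr powr_half_sqrt[symmetric])
  define s where "s = log 2 n / d"
  have s: "0 \<le> s" using n d by (simp add: s_def)
  define L where "L = nat \<lfloor>s\<rfloor>"
  define t where "t = s - L"
  have t: "0 \<le> t" "t \<le> 1" unfolding t_def L_def using s by linarith+
  have "n powr (1 / d) = (2 powr log 2 n) powr (1 / d)"
    using n by simp
  also have "\<dots> = 2 powr s" by (simp add: powr_powr s_def)
  finally have n_powr: "n powr (1 / d) = 2 powr s" .
  have sqrt_n: "sqrt n = 2 powr (s * (d / 2))"
  proof -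
    have "s * (d / 2) = log 2 n * (1 / 2)" using d by (simp add: s_def)
    then show ?thesis using n by (simp add: powr_half_sqrt[symmetric] powr_powr[symmetric] del: times_divide_eq_right)
  qed
  have coarse: "1 / 2 ^ L = 2 powr t / 2 powr s"
    by (simp add: t_def powr_diff powr_realpow)
  have fine: "r ^ L / sqrt n = (1 / r) powr t / 2 powr s"
  proof -
    have "r ^ L = r powr (s - t)" using r by (simp add: t_def powr_realpow)
    also have "\<dots> = r powr s * (1 / r) powr t" using r by (simp add: powr_diff powr_divide)
    also have "r powr s = 2 powr (s * (d / 2) - s)"
      by (simp add: r_powr powr_powr algebra_simps)
    also have "\<dots> = sqrt n / 2 powr s" by (simp add: powr_diff sqrt_n)
    finally show ?thesis using n by simp
  qed
  have "(\<Sum>l<L. r ^ Suc l) = r * ((r ^ L - 1) / (r - 1))"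
    using r by (simp add: sum_distrib_left[symmetric] geometric_sum)
  also have "\<dots> \<le> r * (r ^ L / (r - 1))"
    using r by (intro mult_left_mono divide_right_mono) simp_all
  finally have "(\<Sum>l<L. r ^ Suc l) / (2 * sqrt n) \<le> r * (r ^ L / (r - 1)) / (2 * sqrt n)"
    by (rule divide_right_mono) simp
  also have "\<dots> = r / (2 * (r - 1)) * (r ^ L / sqrt n)" by simp
  finally have "1 / 2 ^ L + (\<Sum>l<L. r ^ Suc l) / (2 * sqrt n)
      \<le> (2 powr t + r / (2 * (r - 1)) * (1 / r) powr t) / 2 powr s"
    unfolding coarse fine by (simp add: add_divide_distrib)
  also have "\<dots> \<le> (2 + 1 / (2 * (r - 1))) / 2 powr s"
  proof (rule divide_right_mono)
    \<comment> \<open>Chords of the convex functions \<open>2 powr t\<close> and \<open>(1 / r) powr t\<close> over the unit interval.\<close>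
    have "2 powr t \<le> 1 + t"
      using Youngs_inequality_0[of t "1 - t" 2 1] t by simp
    moreover have "r / (2 * (r - 1)) * (1 / r) powr t \<le> 1 / (2 * (r - 1)) + (1 - t) / 2"
    proof -
      have "(1 / r) powr t \<le> t * (1 / r) + (1 - t)"
        using Youngs_inequality_0[of t "1 - t" "1 / r" 1] t r by simp
      then have "r / (2 * (r - 1)) * (1 / r) powr t \<le> r / (2 * (r - 1)) * (t * (1 / r) + (1 - t))"
        using r by (intro mult_left_mono) simp_all
      also have "\<dots> = 1 / (2 * (r - 1)) + (1 - t) / 2"
        using r by (simp add: field_simps)
      finally show ?thesis .
    qed
    ultimately have "2 powr t + r / (2 * (r - 1)) * (1 / r) powr t
        \<le> (1 + t) + (1 / (2 * (r - 1)) + (1 - t) / 2)"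
      by (rule add_mono)
    also have "\<dots> \<le> 2 + 1 / (2 * (r - 1))"
      using t by (simp add: field_simps)
    finally show "2 powr t + r / (2 * (r - 1)) * (1 / r) powr t \<le> 2 + 1 / (2 * (r - 1))" .
  qed simp
  finally have "sqrt d * (1 / 2 ^ L + (\<Sum>l<L. r ^ Suc l) / (2 * sqrt n))
      \<le> sqrt d * ((2 + 1 / (2 * (r - 1))) / 2 powr s)"
    by (rule mult_left_mono) simp
  then show ?thesis
    using expected_W1_le_geometric[OF \<mu> iid n, of L]
    unfolding W1_const_def n_powr r_def[symmetric] by simp
qed

lemma W1_const_3: "W1_const 3 \<le> 6.3"
proof -
  have two: "(1.41::real) \<le> sqrt 2" by (rule real_le_rsqrt) (simp add: power2_eq_square)
  have three: "sqrt 3 \<le> (1.74::real)" by (rule real_le_lsqrt) (simp_all add: power2_eq_square)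
  have "scale_ratio 3 = sqrt 2" by (simp add: scale_ratio_def power3_eq_cube)
  then have "W1_const 3 = sqrt 3 * (2 + 1 / (2 * (sqrt 2 - 1)))" by (simp add: W1_const_def)
  also have "\<dots> \<le> 1.74 * (2 + 1 / (2 * (1.41 - 1)))"
    using two three by (intro mult_mono add_left_mono divide_left_mono) simp_all
  also have "\<dots> \<le> 6.3" by simp
  finally show ?thesis .
qed

lemma W1_const_le:
  assumes "d \<ge> 4"
  shows "W1_const d \<le> 3 * sqrt d"
proof -
  have "sqrt 2 ^ 4 \<le> sqrt 2 ^ d" using assms by (intro power_increasing) simp_all
  moreover have "sqrt 2 ^ 4 = (4::real)" using real_sqrt_power[of 2 4] by (simp add: power4_eq_xxxx)
  ultimately have "2 \<le> scale_ratio d" by (simp add: scale_ratio_def)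
  then have "1 / (2 * (scale_ratio d - 1)) \<le> 1" by (simp add: divide_le_eq)
  then have "sqrt d * (2 + 1 / (2 * (scale_ratio d - 1))) \<le> sqrt d * 3"
    by (intro mult_left_mono) simp_all
  then show ?thesis by (simp add: W1_const_def mult.commute)
qed

lemma W1_const_asymptotics: "(\<lambda>d. W1_const d / sqrt d) \<longlonglongrightarrow> 2"
proof -
  \<comment> \<open>In terms of the null sequence \<open>x d = 1 / (2 * scale_ratio d)\<close> the constants are a rational function.\<close>
  define x where "x d = (1 / sqrt 2 :: real) ^ d" for d :: nat
  have x: "x \<longlonglongrightarrow> 0" unfolding x_def by (rule LIMSEQ_power_zero) simp
  have "(\<lambda>d. 2 + x d / (1 - 2 * x d)) \<longlonglongrightarrow> 2 + 0 / (1 - 2 * 0)"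
    by (intro tendsto_intros x) simp
  then have "(\<lambda>d. 2 + x d / (1 - 2 * x d)) \<longlonglongrightarrow> 2" by simp
  moreover have "\<forall>\<^sub>F d in sequentially. 2 + x d / (1 - 2 * x d) = W1_const d / sqrt d"
  proof (rule eventually_sequentiallyI[of 3])
    fix d :: nat assume d: "3 \<le> d"
    have "x d = 1 / (2 * scale_ratio d)"
      by (simp add: x_def scale_ratio_def power_one_over)
    then have "x d / (1 - 2 * x d) = 1 / (2 * (scale_ratio d - 1))"
      using one_less_scale_ratio[OF d] by (simp add: diff_divide_eq_iff divide_divide_eq_left)
    then show "2 + x d / (1 - 2 * x d) = W1_const d / sqrt d"
      using d by (simp add: W1_const_def)
  qed
  ultimately show ?thesis by (rule Lim_transform_eventually)
qed

lemma expected_W1_bound: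
  assumes \<mu>: "prob_space \<mu>" "sets \<mu> = sets (unit_cube d)" and d: "d \<ge> 1"
    and iid: "iid_sequence M \<mu> X" and n: "n \<ge> 1"
  shows "(\<integral>\<omega>. W1 d (empirical_measure \<mu> n (\<lambda>k. X k \<omega>)) \<mu> \<partial>M)
    \<le> (if d = 1 then 1 / (2 * (sqrt 2 - 1)) * (1 / sqrt (real n))
       else if d = 2 then (log 2 (real n) + 8) / sqrt (8 * real n)
       else W1_const d / real n powr (1 / real d))"
proof -
  consider "d = 1" | "d = 2" | "d \<ge> 3" using d by linarith
  then show ?thesis
  proof cases
    case 1
    with expected_W1_dim_1[of \<mu> M X n] \<mu> iid n show ?thesis by simp
  next
    case 2
    with expected_W1_dim_2[of \<mu> M X n] \<mu> iid n show ?thesis by simp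
  next
    case 3
    with expected_W1_dim_ge_3[OF \<mu> iid n 3] show ?thesis by simp
  qed
qed

theorem theorem2:
  "\<exists>C :: nat \<Rightarrow> real.
     C 3 \<le> 6.3 \<and>
     (\<forall>d\<ge>4. C d \<le> 3 * sqrt (real d)) \<and>
     (\<lambda>d. C d / sqrt (real d)) \<longlonglongrightarrow> 2 \<and>
     (\<forall>d\<ge>1. \<forall>\<mu>. prob_space \<mu> \<and> sets \<mu> = sets (unit_cube d) \<longrightarrow>
       (\<forall>n\<ge>1.
         let bound =
           (if d = 1 then 1 / (2 * (sqrt 2 - 1)) * (1 / sqrt (real n))
            else if d = 2 then (log 2 (real n) + 8) / sqrt (8 * real n)
            else C d / real n powr (1 / real d))
         in
           (\<forall>(M :: 'a measure) X. iid_sequence M \<mu> X \<longrightarrow>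
             integrable M (\<lambda>\<omega>. W1 d (empirical_measure \<mu> n (\<lambda>k. X k \<omega>)) \<mu>) \<and>
             (\<integral>\<omega>. W1 d (empirical_measure \<mu> n (\<lambda>k. X k \<omega>)) \<mu> \<partial>M) \<le> bound) \<and>
           (\<forall>(M :: (nat \<Rightarrow> nat \<Rightarrow> real) measure) X. iid_sequence M \<mu> X \<longrightarrow>
             integrable M (\<lambda>\<omega>. W1 d (empirical_measure \<mu> n (\<lambda>k. X k \<omega>)) \<mu>) \<and>
             (\<integral>\<omega>. W1 d (empirical_measure \<mu> n (\<lambda>k. X k \<omega>)) \<mu> \<partial>M) \<le> bound)))"
  unfolding Let_def
proof (intro exI[of _ W1_const] conjI allI impI)
  show "W1_const 3 \<le> 6.3" by (rule W1_const_3)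
  show "W1_const d \<le> 3 * sqrt (real d)" if "4 \<le> d" for d
    using that by (rule W1_const_le)
  show "(\<lambda>d. W1_const d / sqrt (real d)) \<longlonglongrightarrow> 2" by (rule W1_const_asymptotics)
qed (elim conjE, (rule expected_W1_le_multiscale(1) expected_W1_bound; assumption))+

end
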